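(* Consider the dynamic minimum-cost multi-commodity network flow problem $$\text{(F)}\qquad \begin{aligned}\min_{x_p^\ell\in\mathbb{R}_+,\,p\in\mathcal{P}^\ell,\,\ell=1,\dots,L}\ & \sum_{\ell=1}^L\sum_{p\in\mathcal{P}^\ell}c_p^\ell x_p^\ell\\ \text{s.t. } & \sum_{p\in\mathcal{P}^\ell}\delta_{e=p_1}x_p^\ell=r_e^{\ell,+}\ \text{ for } e\in\mathcal{S}^{\ell,+},\ \ell=1,\dots,L,\\ & \sum_{p\in\mathcal{P}^\ell}\delta_{e=p_{\mathcal{T}}}x_p^\ell=r_e^{\ell,-}\ \text{ for } e\in\mathcal{S}^{\ell,-},\ \ell=1,\dots,L,\\ & \sum_{\ell=1}^L\sum_{p\in\mathcal{P}^\ell}\delta_{e=p_t}x_p^\ell\le d_e\ \text{ for } e\in\mathcal{E},\ t=2,\dots,\mathcal{T}-1,\end{aligned}$$ and the structured multi-marginal optimal transport problem $$\text{(OT)}\qquad \begin{aligned}\min_{\mathbf{M}\in\mathbb{R}_+^{L\times n^{\mathcal{T}}}}\ & \langle\mathbf{C},\mathbf{M}\rangle\\ \text{s.t. } & P_{0,1}(\mathbf{M})=R^{(0,1)},\quad P_{0,\mathcal{T}}(\mathbf{M})=R^{(0,\mathcal{T})},\\ & P_t(\mathbf{M})\le d\ \text{ for } t=2,\dots,\mathcal{T}-1,\end{aligned}$$ where $$\mathbf{C}_{i_0i_1\dots i_{\mathcal{T}}}=\sum_{t=2}^{\mathcal{T}-1}(C_L)_{i_0i_t}+\sum_{t=1}^{\mathcal{T}-1}C_{i_ti_{t+1}},$$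 with all data as defined in the context. These problems correspond to each other in the following sense. 1. Assume that (OT) has a feasible solution with finite objective value. Then (OT) has a finite optimal value, and (F) has the same optimal value. Moreover, if $\mathbf{M}$ is an optimal solution of (OT), then there is an optimal solution $\{x_p^\ell : p\in\mathcal{P}^\ell,\ \ell=1,\dots,L\}$ of (F) such that $$(\ast)\qquad \mathbf{M}_{\ell,i_1\dots i_{\mathcal{T}}}=\begin{cases}x_p^\ell & \text{for } (i_1,\dots,i_{\mathcal{T}})\in\mathcal{P}^\ell,\ \text{where } p=(i_1,\dots,i_{\mathcal{T}}),\\ 0 & \text{for } (i_1,\dots,i_{\mathcal{T}})\in\tilde{\mathcal{P}}\setminus\mathcal{P}^\ell.\end{cases}$$ 2. Assume that there is a finite feasible solution to (F). Then (F) has a finite optimal value, and (OT) has the same optimal value. Moreover, if $\{x_p^\ell : p\in\mathcal{P}^\ell,\ \ell=1,\dots,L\}$ is an optimal solution of (F), then there is an optimal solution $\mathbf{M}$ of (OT) such that $(\ast)$ holds.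
   Context: $\mathcal{N}=(\mathcal{V},\mathcal{E})$ is a finite directed network with $n=|\mathcal{E}|$ edges, $\mathcal{T}\ge 2$ is an integer number of time steps, and $L\geq 1$ is the number of commodities. Each commodity $\ell$ has sources $\mathcal{S}^{\ell,+}\subset\mathcal{E}$ with supplies $r_e^{\ell,+}\in\mathbb{R}_+$ and sinks $\mathcal{S}^{\ell,-}\subset\mathcal{E}$ with demands $r_e^{\ell,-}\in\mathbb{R}_+$, where total supply equals total demand for each commodity: $\sum_{e\in\mathcal{S}^{\ell,+}}r_e^{\ell,+}=\sum_{e\in\mathcal{S}^{\ell,-}}r_e^{\ell,-}$. The cost of a unit flow of commodity $\ell$ on edge $e$ is $c_e^\ell\in\mathbb{R}_+$, and $d=(d_e)_{e\in\mathcal{E}}\in\mathbb{R}_+^n$ are the edge capacities. Here $\mathbb{R}_+$ denotes the nonnegative reals, and $\overline{\mathbb{R}}_+=\mathbb{R}_+\cup\{\infty\}$, with the convention $0\cdot\infty=0$. The time-expanded network has vertices $(t,v)$ for $t=0,\dots,\mathcal{T}$, $v\in\mathcal{V}$, and edges $\bigcup_{t=1}^{\mathcal{T}}\mathcal{E}_t$ with $\mathcal{E}_t=\{((t-1,v),(t,w)) : (v,w)\in\mathcal{E}\}$; each $\mathcal{E}_t$ is canonically identified with $\mathcal{E}$, with the same costs and capacities. $\tilde{\mathcal{P}}=\{(i_1,\dots,i_{\mathcal{T}}) : i_t\in\mathcal{E}_t \text{ for } t=1,\dots,\mathcal{T}\}$ is the set of all tuples of edges, and $\mathcal{P}^\ell\subset\tilde{\mathcal{P}}$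 is the set of feasible paths for commodity $\ell$: tuples $p=(p_1,\dots,p_{\mathcal{T}})$ such that $p_t$ ends in the initial vertex of $p_{t+1}$ in the time-expanded network for all $t=1,\dots,\mathcal{T}-1$, with $p_1\in\mathcal{S}^{\ell,+}$ and $p_{\mathcal{T}}\in\mathcal{S}^{\ell,-}$. The path cost is $c_p^\ell=\sum_{t=1}^{\mathcal{T}}c_{p_t}^\ell$. $\delta_{e=p_t}$ equals $1$ if $e=p_t$ and $0$ otherwise. Tensors $\mathbf{M}\in\mathbb{R}_+^{L\times n^{\mathcal{T}}}=\mathbb{R}_+^{L\times n\times\cdots\times n}$ have $\mathcal{T}+1$ modes, numbered $0,\dots,\mathcal{T}$, with indices $i_0=\ell\in\{1,\dots,L\}$ and $i_1,\dots,i_{\mathcal{T}}\in\mathcal{E}$. The projection $P_t(\mathbf{M})$ on mode $t$ is the vector obtained by summing over all indices except $i_t$; the bi-marginal projection $P_{t_1,t_2}(\mathbf{M})$ is the matrix indexed by $(i_{t_1},i_{t_2})$ obtained by summing over all other indices; $\langle\mathbf{C},\mathbf{M}\rangle$ is the sum of entrywise products. Vector inequalities are elementwise. The matrix $C\in\overline{\mathbb{R}}_+^{n\times n}$ encodes the network topology: $C_{ij}=0$ if edge $i$ leads to edge $j$ (the second vertex of $i$ is the first vertex of $j$ in $\mathcal{N}$), and $C_{ij}=\infty$ otherwise. The matrix $C_L\in\mathbb{R}_+^{L\times n}$ has entries $(C_L)_{\ell,e}=c_e^\ell$. These two matrices define the cost tensor $\mathbf{C}\in\overline{\mathbb{R}}_+^{L\times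 n^{\mathcal{T}}}$ by the formula in the claim. The matrices $R^{(0,1)},R^{(0,\mathcal{T})}\in\mathbb{R}_+^{L\times n}$ collect the initial and final distributions of the commodities: $R^{(0,1)}_{\ell,e}=r_e^{\ell,+}$ if $e\in\mathcal{S}^{\ell,+}$ and $0$ otherwise, and $R^{(0,\mathcal{T})}_{\ell,e}=r_e^{\ell,-}$ if $e\in\mathcal{S}^{\ell,-}$ and $0$ otherwise.
   Formalization: "Same optimal value" fails if source/sink edges have cost, as the tensor omits steps 1 and T; proved instead: value(F) = value(OT) + sum over commodities of c·r on source and on sink edges, so the values are equal when source and sink edges have zero cost. *)

theory Defs
  imports "HOL-Analysis.Analysis" "Graph_Theory.Pair_Digraph"
begin

text \<open>
  Network edges are pairs of vertices (loops are allowed, parallel edges are not). Commodities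
  are numbered from 1 to \<open>commodities\<close>; time steps run from 1 to \<open>horizon\<close>.
\<close>

record 'v flow_data =
  network     :: "'v pair_pre_digraph"
  horizon     :: nat
  commodities :: nat
  sources     :: "nat \<Rightarrow> ('v \<times> 'v) set"
  sinks       :: "nat \<Rightarrow> ('v \<times> 'v) set"
  supply_at   :: "nat \<Rightarrow> 'v \<times> 'v \<Rightarrow> real"
  demand_at   :: "nat \<Rightarrow> 'v \<times> 'v \<Rightarrow> real"
  edge_cost   :: "nat \<Rightarrow> 'v \<times> 'v \<Rightarrow> real"
  capacity    :: "'v \<times> 'v \<Rightarrow> real"

definition edges :: "'v flow_data \<Rightarrow> ('v \<times> 'v) set" where
  "edges D = parcs (network D)"

definition comms :: "'v flow_data \<Rightarrow> nat set" where
  "comms D = {1..commodities D}"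

definition valid_flow_data :: "'v flow_data \<Rightarrow> bool" where
  "valid_flow_data D \<longleftrightarrow>
     pair_fin_digraph (network D) \<and> horizon D \<ge> 2 \<and> commodities D \<ge> 1 \<and>
     (\<forall>l\<in>comms D.
        sources D l \<subseteq> edges D \<and> sinks D l \<subseteq> edges D \<and>
        (\<forall>e\<in>sources D l. supply_at D l e \<ge> 0) \<and>
        (\<forall>e\<in>sinks D l. demand_at D l e \<ge> 0) \<and>
        (\<Sum>e\<in>sources D l. supply_at D l e) = (\<Sum>e\<in>sinks D l. demand_at D l e) \<and>
        (\<forall>e\<in>edges D. edge_cost D l e \<ge> 0)) \<and>
     (\<forall>e\<in>edges D. capacity D e \<ge> 0)"

text \<open>
  The copy of the edge \<open>e\<close> between layers \<open>t - 1\<close> and \<open>t\<close> of the time-expanded network (used only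
  for \<open>t \<ge> 1\<close>). Through this identification of each layer with the edge set of the network, tuples
  of time-expanded edges are represented as extensional functions from \<open>{1..horizon}\<close> to network
  edges.
\<close>

definition time_edge :: "nat \<Rightarrow> 'v \<times> 'v \<Rightarrow> (nat \<times> 'v) \<times> (nat \<times> 'v)" where
  "time_edge t e = ((t - 1, fst e), (t, snd e))"

type_synonym 'v edge_tuple = "nat \<Rightarrow> 'v \<times> 'v"

definition tuples :: "'v flow_data \<Rightarrow> 'v edge_tuple set" where
  "tuples D = {1..horizon D} \<rightarrow>\<^sub>E edges D"

definition paths :: "'v flow_data \<Rightarrow> nat \<Rightarrow> 'v edge_tuple set" where
  "paths D l = {p \<in> tuples D.
     (\<forall>t\<in>{1..horizon D - 1}. snd (time_edge t (p t)) = fst (time_edge (t + 1) (p (t + 1)))) \<and>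
     p 1 \<in> sources D l \<and> p (horizon D) \<in> sinks D l}"

definition path_cost :: "'v flow_data \<Rightarrow> nat \<Rightarrow> 'v edge_tuple \<Rightarrow> real" where
  "path_cost D l p = (\<Sum>t = 1..horizon D. edge_cost D l (p t))"

text \<open>
  In both problems only the values at commodities in \<open>comms D\<close> and at feasible paths, respectively
  tuples, matter; values elsewhere are irrelevant junk.
\<close>

definition flow_objective :: "'v flow_data \<Rightarrow> (nat \<Rightarrow> 'v edge_tuple \<Rightarrow> real) \<Rightarrow> real" where
  "flow_objective D x = (\<Sum>l\<in>comms D. \<Sum>p\<in>paths D l. path_cost D l p * x l p)"

definition flow_feasible :: "'v flow_data \<Rightarrow> (nat \<Rightarrow> 'v edge_tuple \<Rightarrow> real) \<Rightarrow> bool" where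
  "flow_feasible D x \<longleftrightarrow>
     (\<forall>l\<in>comms D. \<forall>p\<in>paths D l. x l p \<ge> 0) \<and>
     (\<forall>l\<in>comms D. \<forall>e\<in>sources D l.
        (\<Sum>p\<in>paths D l. of_bool (e = p 1) * x l p) = supply_at D l e) \<and>
     (\<forall>l\<in>comms D. \<forall>e\<in>sinks D l.
        (\<Sum>p\<in>paths D l. of_bool (e = p (horizon D)) * x l p) = demand_at D l e) \<and>
     (\<forall>e\<in>edges D. \<forall>t\<in>{2..horizon D - 1}.
        (\<Sum>l\<in>comms D. \<Sum>p\<in>paths D l. of_bool (e = p t) * x l p) \<le> capacity D e)"

text \<open>
  A tensor is a function of its mode-0 index (a commodity) and of the tuple of its indices in modes
  1 to \<open>horizon\<close>. \<open>proj D t\<close> is the projection on a mode \<open>t \<ge> 1\<close>, and \<open>proj0 D t\<close> the bi-marginal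
  projection on modes 0 and \<open>t\<close>.
\<close>

definition proj :: "'v flow_data \<Rightarrow> nat \<Rightarrow> (nat \<Rightarrow> 'v edge_tuple \<Rightarrow> real) \<Rightarrow> 'v \<times> 'v \<Rightarrow> real" where
  "proj D t M e = (\<Sum>l\<in>comms D. \<Sum>i\<in>{i \<in> tuples D. i t = e}. M l i)"

definition proj0 ::
  "'v flow_data \<Rightarrow> nat \<Rightarrow> (nat \<Rightarrow> 'v edge_tuple \<Rightarrow> real) \<Rightarrow> nat \<Rightarrow> 'v \<times> 'v \<Rightarrow> real" where
  "proj0 D t M l e = (\<Sum>i\<in>{i \<in> tuples D. i t = e}. M l i)"

definition initial_dist :: "'v flow_data \<Rightarrow> nat \<Rightarrow> 'v \<times> 'v \<Rightarrow> real" where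
  "initial_dist D l e = (if e \<in> sources D l then supply_at D l e else 0)"

definition final_dist :: "'v flow_data \<Rightarrow> nat \<Rightarrow> 'v \<times> 'v \<Rightarrow> real" where
  "final_dist D l e = (if e \<in> sinks D l then demand_at D l e else 0)"

definition topology_cost :: "'v \<times> 'v \<Rightarrow> 'v \<times> 'v \<Rightarrow> ennreal" where
  "topology_cost i j = (if snd i = fst j then 0 else \<infinity>)"

definition cost_tensor :: "'v flow_data \<Rightarrow> nat \<Rightarrow> 'v edge_tuple \<Rightarrow> ennreal" where
  "cost_tensor D l i =
     (\<Sum>t = 2..horizon D - 1. ennreal (edge_cost D l (i t))) +
     (\<Sum>t = 1..horizon D - 1. topology_cost (i t) (i (t + 1)))"

text \<open>Multiplication on \<^typ>\<open>ennreal\<close> satisfies \<open>\<infinity> * 0 = 0\<close>.\<close>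

definition ot_objective :: "'v flow_data \<Rightarrow> (nat \<Rightarrow> 'v edge_tuple \<Rightarrow> real) \<Rightarrow> ennreal" where
  "ot_objective D M = (\<Sum>l\<in>comms D. \<Sum>i\<in>tuples D. cost_tensor D l i * ennreal (M l i))"

definition ot_feasible :: "'v flow_data \<Rightarrow> (nat \<Rightarrow> 'v edge_tuple \<Rightarrow> real) \<Rightarrow> bool" where
  "ot_feasible D M \<longleftrightarrow>
     (\<forall>l\<in>comms D. \<forall>i\<in>tuples D. M l i \<ge> 0) \<and>
     (\<forall>l\<in>comms D. \<forall>e\<in>edges D. proj0 D 1 M l e = initial_dist D l e) \<and>
     (\<forall>l\<in>comms D. \<forall>e\<in>edges D. proj0 D (horizon D) M l e = final_dist D l e) \<and>
     (\<forall>t\<in>{2..horizon D - 1}. \<forall>e\<in>edges D. proj D t M e \<le> capacity D e)"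

abbreviation flow_optimal :: "'v flow_data \<Rightarrow> (nat \<Rightarrow> 'v edge_tuple \<Rightarrow> real) \<Rightarrow> bool" where
  "flow_optimal D \<equiv> is_arg_min (flow_objective D) (flow_feasible D)"

abbreviation ot_optimal :: "'v flow_data \<Rightarrow> (nat \<Rightarrow> 'v edge_tuple \<Rightarrow> real) \<Rightarrow> bool" where
  "ot_optimal D \<equiv> is_arg_min (ot_objective D) (ot_feasible D)"

text \<open>The optimal value of a minimisation problem, understood as an attained minimum.\<close>

definition has_optimal_value :: "('a \<Rightarrow> 'b::linorder) \<Rightarrow> ('a \<Rightarrow> bool) \<Rightarrow> 'b \<Rightarrow> bool" where
  "has_optimal_value f P v \<longleftrightarrow> (\<exists>x. is_arg_min f P x \<and> f x = v)"

text \<open>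
  The path cost charges all time steps from 1 to \<open>horizon\<close>, whereas the cost tensor charges only
  steps 2 to \<open>horizon - 1\<close>. The cost of the first and the last step is fixed by the supply and demand
  constraints; it is the same for all feasible flows and equals the following constant, by which
  the two optimal values differ. It vanishes when source and sink edges carry no cost.
\<close>

definition terminal_cost :: "'v flow_data \<Rightarrow> real" where
  "terminal_cost D = (\<Sum>l\<in>comms D.
     (\<Sum>e\<in>sources D l. edge_cost D l e * supply_at D l e) +
     (\<Sum>e\<in>sinks D l. edge_cost D l e * demand_at D l e))"

definition zero_terminal_edge_costs :: "'v flow_data \<Rightarrow> bool" where
  "zero_terminal_edge_costs D \<longleftrightarrow>
     (\<forall>l\<in>comms D. \<forall>e\<in>sources D l \<union> sinks D l. edge_cost D l e = 0)"

definition corresponds ::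
  "'v flow_data \<Rightarrow> (nat \<Rightarrow> 'v edge_tuple \<Rightarrow> real) \<Rightarrow> (nat \<Rightarrow> 'v edge_tuple \<Rightarrow> real) \<Rightarrow> bool" where
  "corresponds D M x \<longleftrightarrow>
     (\<forall>l\<in>comms D. \<forall>i\<in>tuples D. M l i = (if i \<in> paths D l then x l i else 0))"

end

theory Submission
  imports Defs
begin

text \<open>
  A tensor of finite cost vanishes on tuples that are not chained, and the bi-marginals on modes
  \<open>(0, 1)\<close> and \<open>(0, horizon)\<close> force it to vanish on tuples that do not start at a source or do not end
  at a sink. It is therefore supported on the feasible paths, where the two constraint systems
  coincide; conversely, a flow becomes such a tensor when extended by zero. Under this
  correspondence the objectives differ by the constant \<open>terminal_cost\<close>, because the mass on every
  first and last edge is prescribed. The minimum of the flow problem is attained since each path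
  flow is bounded by the supply of its first edge, so that the feasible set is essentially compact.
\<close>

text \<open>Serves the closedness of the flow constraints, which are nested bounded quantifiers: an
  intersection of closed sets is closed.\<close>

lemma closed_Collect_ball:
  assumes "\<And>i. i \<in> I \<Longrightarrow> closed {x. P i x}"
  shows "closed {x. \<forall>i\<in>I. P i x}"
  using assms by (simp add: Collect_ball_eq closed_INT)

context
  fixes D :: "'v flow_data"
  assumes valid: "valid_flow_data D"
begin

definition supported :: "(nat \<Rightarrow> 'v edge_tuple \<Rightarrow> real) \<Rightarrow> bool" where
  "supported M \<longleftrightarrow> (\<forall>l\<in>comms D. \<forall>i\<in>tuples D. i \<notin> paths D l \<longrightarrow> M l i = 0)"

text \<open>Values off the paths and off \<open>comms D\<close> are junk. Cutting them to zero turns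
  a flow into a supported tensor and places it in the compact box used for the existence of a
  minimum.\<close>

definition extend_by_zero :: "(nat \<Rightarrow> 'v edge_tuple \<Rightarrow> real) \<Rightarrow> nat \<Rightarrow> 'v edge_tuple \<Rightarrow> real" where
  "extend_by_zero x l i = (if l \<in> comms D \<and> i \<in> paths D l then x l i else 0)"

section \<open>Finiteness and elementary facts on tuples, paths and terminals\<close>

lemma horizon_ge_2: "horizon D \<ge> 2"
  using valid by (simp add: valid_flow_data_def)

lemma finite_edges: "finite (edges D)"
  using valid pair_fin_digraph.axioms(2)[of "network D"]
  by (simp add: valid_flow_data_def edges_def pair_fin_digraph_axioms_def)

lemma finite_tuples: "finite (tuples D)"
  unfolding tuples_def by (intro finite_PiE finite_edges) simp

lemma paths_subset_tuples: "paths D l \<subseteq> tuples D"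
  by (auto simp: paths_def)

lemma finite_paths: "finite (paths D l)"
  using paths_subset_tuples finite_tuples by (rule finite_subset)

lemma finite_comms: "finite (comms D)"
  by (simp add: comms_def)

lemma tuples_edge: "i \<in> tuples D \<Longrightarrow> t \<in> {1..horizon D} \<Longrightarrow> i t \<in> edges D"
  by (auto simp: tuples_def)

lemma terminals_subset_edges:
  assumes "l \<in> comms D"
  shows "sources D l \<subseteq> edges D" "sinks D l \<subseteq> edges D"
  using valid assms by (auto simp: valid_flow_data_def)

lemma finite_terminals:
  assumes "l \<in> comms D"
  shows "finite (sources D l)" "finite (sinks D l)"
  using terminals_subset_edges[OF assms] finite_edges by (auto intro: finite_subset)

lemma edge_cost_nonneg: "l \<in> comms D \<Longrightarrow> e \<in> edges D \<Longrightarrow> edge_cost D l e \<ge> 0"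
  using valid by (auto simp: valid_flow_data_def)

lemma path_iff:
  assumes "i \<in> tuples D"
  shows "i \<in> paths D l \<longleftrightarrow>
    (\<forall>t\<in>{1..horizon D - 1}. snd (i t) = fst (i (t + 1))) \<and>
    i 1 \<in> sources D l \<and> i (horizon D) \<in> sinks D l"
  using assms by (auto simp: paths_def time_edge_def)

section \<open>Marginals of supported tensors and the two constraint systems\<close>

lemma proj0_supported:
  assumes "supported M" "l \<in> comms D"
  shows "proj0 D t M l e = (\<Sum>p\<in>paths D l. of_bool (e = p t) * M l p)"
proof -
  have "proj0 D t M l e = (\<Sum>i\<in>tuples D. of_bool (e = i t) * M l i)"
    unfolding proj0_def
    by (rule sum.mono_neutral_cong_left) (use finite_tuples in auto)
  also have "\<dots> = (\<Sum>p\<in>paths D l. of_bool (e = p t) * M l p)"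
    by (rule sum.mono_neutral_right)
      (use finite_tuples paths_subset_tuples assms in \<open>auto simp: supported_def\<close>)
  finally show ?thesis .
qed

lemma proj_eq_sum_proj0: "proj D t M e = (\<Sum>l\<in>comms D. proj0 D t M l e)"
  by (simp add: proj_def proj0_def)

text \<open>Provides the zero entries of \<open>initial_dist\<close> and \<open>final_dist\<close>,
  for which the flow problem states no constraint.\<close>

lemma path_marginal_outside:
  assumes "\<And>p. p \<in> paths D l \<Longrightarrow> p t \<noteq> e"
  shows "(\<Sum>p\<in>paths D l. of_bool (e = p t) * M l p) = (0::real)"
  by (rule sum.neutral) (use assms in auto)

text \<open>The tensor constraints prescribe end marginals on all edges, the flow constraints only
  on sources and sinks. The additional equations read 0 = 0, because paths start at sources and end
  at sinks; the other constraints are the same sums over paths.\<close>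

lemma feasible_iff_if_supported:
  assumes sup: "supported M"
  shows "ot_feasible D M \<longleftrightarrow> flow_feasible D M"
proof -
  have nonneg: "(\<forall>i\<in>tuples D. M l i \<ge> 0) \<longleftrightarrow> (\<forall>p\<in>paths D l. M l p \<ge> 0)" if "l \<in> comms D" for l
    using sup that paths_subset_tuples unfolding supported_def by (metis order_refl subsetD)
  have first: "(\<forall>e\<in>edges D. proj0 D 1 M l e = initial_dist D l e) \<longleftrightarrow>
      (\<forall>e\<in>sources D l. (\<Sum>p\<in>paths D l. of_bool (e = p 1) * M l p) = supply_at D l e)"
    if l: "l \<in> comms D" for l
  proof -
    have "(\<Sum>p\<in>paths D l. of_bool (e = p 1) * M l p) = 0" if "e \<notin> sources D l" for e
      using that by (intro path_marginal_outside) (auto simp: paths_def)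
    then show ?thesis
      using terminals_subset_edges[OF l] by (auto simp: proj0_supported[OF sup l] initial_dist_def)
  qed
  have last: "(\<forall>e\<in>edges D. proj0 D (horizon D) M l e = final_dist D l e) \<longleftrightarrow>
      (\<forall>e\<in>sinks D l. (\<Sum>p\<in>paths D l. of_bool (e = p (horizon D)) * M l p) = demand_at D l e)"
    if l: "l \<in> comms D" for l
  proof -
    have "(\<Sum>p\<in>paths D l. of_bool (e = p (horizon D)) * M l p) = 0" if "e \<notin> sinks D l" for e
      using that by (intro path_marginal_outside) (auto simp: paths_def)
    then show ?thesis
      using terminals_subset_edges[OF l] by (auto simp: proj0_supported[OF sup l] final_dist_def)
  qed
  have "proj D t M e = (\<Sum>l\<in>comms D. \<Sum>p\<in>paths D l. of_bool (e = p t) * M l p)" for t e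
    unfolding proj_eq_sum_proj0 using sup by (intro sum.cong proj0_supported) auto
  then show ?thesis
    unfolding ot_feasible_def flow_feasible_def using nonneg first last by auto
qed

section \<open>Support of tensors of finite cost\<close>

lemma finite_cost_imp_chained:
  assumes "cost_tensor D l i < \<infinity>" "t \<in> {1..horizon D - 1}"
  shows "snd (i t) = fst (i (t + 1))"
proof -
  have "topology_cost (i t) (i (t + 1)) < \<infinity>"
    using assms by (auto simp: cost_tensor_def)
  then show ?thesis
    by (auto simp: topology_cost_def split: if_splits)
qed

text \<open>Nonnegative entries cannot cancel in a marginal.\<close>

lemma mass_zero_if_proj0_zero:
  assumes "\<And>i. i \<in> tuples D \<Longrightarrow> M l i \<ge> 0" "i \<in> tuples D" "proj0 D t M l (i t) = 0"
  shows "M l i = 0"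
proof -
  have "(\<Sum>j\<in>{j \<in> tuples D. j t = i t}. M l j) = 0 \<longleftrightarrow> (\<forall>j\<in>{j \<in> tuples D. j t = i t}. M l j = 0)"
    by (rule sum_nonneg_eq_0_iff) (use assms(1) finite_tuples in auto)
  then show ?thesis
    using assms(2,3) by (auto simp: proj0_def)
qed

text \<open>A non-zero entry needs finite cost, hence a chained tuple; it also makes its own two end
  marginals non-zero, hence the tuple starts at a source and ends at a sink.\<close>

lemma supported_if_finite_objective:
  assumes feas: "ot_feasible D M" and fin: "ot_objective D M < \<infinity>"
  shows "supported M"
  unfolding supported_def
proof (intro ballI impI)
  fix l i
  assume l: "l \<in> comms D" and i: "i \<in> tuples D" and no_path: "i \<notin> paths D l"
  have nonneg: "\<And>i. i \<in> tuples D \<Longrightarrow> M l i \<ge> 0"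
    using feas l by (simp add: ot_feasible_def)
  have T: "1 \<in> {1..horizon D}" "horizon D \<in> {1..horizon D}"
    using horizon_ge_2 by auto
  show "M l i = 0"
  proof (rule ccontr)
    assume nz: "M l i \<noteq> 0"
    have "(\<Sum>i\<in>tuples D. cost_tensor D l i * ennreal (M l i)) < \<infinity>"
      using fin l finite_comms by (auto simp: ot_objective_def)
    then have "cost_tensor D l i * ennreal (M l i) < \<infinity>"
      using i finite_tuples by auto
    \<comment> \<open>Only a zero entry could absorb an infinite cost, since 0 * \<infinity> =
      0.\<close>
    moreover have "ennreal (M l i) \<noteq> 0"
      using nz nonneg[OF i] by simp
    ultimately have "cost_tensor D l i < \<infinity>"
      by (auto simp: ennreal_mult_less_top top.not_eq_extremum)
    then have chained: "\<forall>t\<in>{1..horizon D - 1}. snd (i t) = fst (i (t + 1))"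
      using finite_cost_imp_chained by blast
    have "proj0 D 1 M l (i 1) \<noteq> 0" "proj0 D (horizon D) M l (i (horizon D)) \<noteq> 0"
      using mass_zero_if_proj0_zero[of M l i] nonneg i nz by blast+
    then have "initial_dist D l (i 1) \<noteq> 0" "final_dist D l (i (horizon D)) \<noteq> 0"
      using feas l tuples_edge[OF i] T by (auto simp: ot_feasible_def)
    then show False
      using chained no_path i by (auto simp: path_iff initial_dist_def final_dist_def split: if_splits)
  qed
qed

section \<open>Comparison of the two objectives\<close>

definition inner_cost :: "nat \<Rightarrow> 'v edge_tuple \<Rightarrow> real" where
  "inner_cost l p = (\<Sum>t = 2..horizon D - 1. edge_cost D l (p t))"

lemma inner_cost_nonneg:
  assumes "l \<in> comms D" "p \<in> tuples D"
  shows "inner_cost l p \<ge> 0"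
  unfolding inner_cost_def using assms
  by (intro sum_nonneg edge_cost_nonneg tuples_edge) auto

lemma cost_tensor_path:
  assumes l: "l \<in> comms D" and p: "p \<in> paths D l"
  shows "cost_tensor D l p = ennreal (inner_cost l p)"
proof -
  have t: "p \<in> tuples D"
    using p paths_subset_tuples by blast
  have "(\<Sum>t = 1..horizon D - 1. topology_cost (p t) (p (t + 1))) = 0"
    using p path_iff[OF t, of l] by (intro sum.neutral) (auto simp: topology_cost_def)
  moreover have "(\<Sum>t = 2..horizon D - 1. ennreal (edge_cost D l (p t))) = ennreal (inner_cost l p)"
    unfolding inner_cost_def using l t
    by (intro sum_ennreal edge_cost_nonneg tuples_edge) auto
  ultimately show ?thesis
    by (simp add: cost_tensor_def)
qed

lemma path_cost_eq:
  "path_cost D l p = edge_cost D l (p 1) + inner_cost l p + edge_cost D l (p (horizon D))"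
proof -
  \<comment> \<open>The bound \<open>horizon D \<ge> 2\<close> keeps the first and the last step
    distinct; at 2 the inner range is empty.\<close>
  have "{1..horizon D} = insert 1 (insert (horizon D) {2..horizon D - 1})"
    using horizon_ge_2 by auto
  moreover have "1 \<notin> insert (horizon D) {2..horizon D - 1}" "horizon D \<notin> {2..horizon D - 1}"
    using horizon_ge_2 by auto
  ultimately show ?thesis
    by (simp add: path_cost_def inner_cost_def)
qed

text \<open>Paths are grouped by the edge they use at step \<open>t\<close>, so a cost depending on
  this edge alone sees the flow only through its marginal \<open>r\<close>. With \<open>E\<close>
  the sources or the sinks, the end costs become constants.\<close>

lemma sum_path_marginal:
  assumes "finite E" "\<And>p. p \<in> paths D l \<Longrightarrow> p t \<in> E"
    and "\<And>e. e \<in> E \<Longrightarrow> (\<Sum>p\<in>paths D l. of_bool (e = p t) * x p) = r e"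
  shows "(\<Sum>p\<in>paths D l. c (p t) * x p) = (\<Sum>e\<in>E. c e * (r e :: real))"
proof -
  have "(\<Sum>e\<in>E. c e * r e) = (\<Sum>e\<in>E. \<Sum>p\<in>paths D l. of_bool (e = p t) * (c e * x p))"
    by (intro sum.cong refl, subst assms(3)[symmetric], assumption)
      (simp add: sum_distrib_left mult_ac)
  also have "\<dots> = (\<Sum>p\<in>paths D l. \<Sum>e\<in>E. of_bool (e = p t) * (c e * x p))"
    by (rule sum.swap)
  also have "\<dots> = (\<Sum>p\<in>paths D l. c (p t) * x p)"
  proof (intro sum.cong refl)
    fix p
    assume p: "p \<in> paths D l"
    \<comment> \<open>The indicator is put in the form that \<open>sum.delta\<close> collapses to
      the single edge \<open>p t\<close> of \<open>E\<close>.\<close>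
    have "(\<Sum>e\<in>E. of_bool (e = p t) * (c e * x p)) = (\<Sum>e\<in>E. if e = p t then c e * x p else 0)"
      by (intro sum.cong) auto
    also have "\<dots> = c (p t) * x p"
      using assms(1) assms(2)[OF p] by (simp add: sum.delta)
    finally show "(\<Sum>e\<in>E. of_bool (e = p t) * (c e * x p)) = c (p t) * x p" .
  qed
  finally show ?thesis by simp
qed

text \<open>Splitting each path cost into first, inner and last steps leaves two end sums that the
  supply and demand constraints fix.\<close>

lemma flow_objective_eq:
  assumes feas: "flow_feasible D x"
  shows "flow_objective D x =
    (\<Sum>l\<in>comms D. \<Sum>p\<in>paths D l. inner_cost l p * x l p) + terminal_cost D"
proof -
  have "(\<Sum>p\<in>paths D l. path_cost D l p * x l p) =
      (\<Sum>p\<in>paths D l. inner_cost l p * x l p) +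
      ((\<Sum>e\<in>sources D l. edge_cost D l e * supply_at D l e) +
       (\<Sum>e\<in>sinks D l. edge_cost D l e * demand_at D l e))" if l: "l \<in> comms D" for l
  proof -
    have "(\<Sum>p\<in>paths D l. edge_cost D l (p 1) * x l p) =
        (\<Sum>e\<in>sources D l. edge_cost D l e * supply_at D l e)"
      using feas l finite_terminals[OF l]
      by (intro sum_path_marginal) (auto simp: flow_feasible_def paths_def)
    moreover have "(\<Sum>p\<in>paths D l. edge_cost D l (p (horizon D)) * x l p) =
        (\<Sum>e\<in>sinks D l. edge_cost D l e * demand_at D l e)"
      using feas l finite_terminals[OF l]
      by (intro sum_path_marginal) (auto simp: flow_feasible_def paths_def)
    ultimately show ?thesis
      by (simp add: path_cost_eq distrib_right sum.distrib)
  qed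
  then show ?thesis
    by (simp add: flow_objective_def terminal_cost_def sum.distrib)
qed

text \<open>Ensures that \<open>ennreal\<close> does not truncate the difference of the two values,
  so that inequalities can be taken back to the reals.\<close>

lemma flow_objective_ge_terminal_cost:
  assumes "flow_feasible D x"
  shows "terminal_cost D \<le> flow_objective D x"
proof -
  have "(\<Sum>l\<in>comms D. \<Sum>p\<in>paths D l. inner_cost l p * x l p) \<ge> 0"
    using assms paths_subset_tuples
    by (intro sum_nonneg mult_nonneg_nonneg inner_cost_nonneg) (auto simp: flow_feasible_def)
  then show ?thesis
    by (simp add: flow_objective_eq[OF assms])
qed

text \<open>On paths the tensor cost is the finite inner cost; other tuples contribute 0, even at
  infinite cost. Nonnegativity of all terms lets \<open>ennreal\<close> be pulled out of the
  sums.\<close>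

lemma ot_objective_supported:
  assumes sup: "supported M" and feas: "flow_feasible D M"
  shows "ot_objective D M = ennreal (flow_objective D M - terminal_cost D)"
proof -
  have term_nonneg: "inner_cost l p * M l p \<ge> 0" if "l \<in> comms D" "p \<in> paths D l" for l p
    using that feas paths_subset_tuples
    by (intro mult_nonneg_nonneg inner_cost_nonneg) (auto simp: flow_feasible_def)
  have "(\<Sum>i\<in>tuples D. cost_tensor D l i * ennreal (M l i)) =
      ennreal (\<Sum>p\<in>paths D l. inner_cost l p * M l p)" if l: "l \<in> comms D" for l
  proof -
    have "(\<Sum>i\<in>tuples D. cost_tensor D l i * ennreal (M l i)) =
        (\<Sum>p\<in>paths D l. cost_tensor D l p * ennreal (M l p))"
      by (rule sum.mono_neutral_right)
        (use finite_tuples paths_subset_tuples sup l in \<open>auto simp: supported_def\<close>)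
    also have "\<dots> = (\<Sum>p\<in>paths D l. ennreal (inner_cost l p * M l p))"
    proof (intro sum.cong refl)
      fix p
      assume p: "p \<in> paths D l"
      have "inner_cost l p \<ge> 0"
        using l p paths_subset_tuples by (intro inner_cost_nonneg) auto
      then show "cost_tensor D l p * ennreal (M l p) = ennreal (inner_cost l p * M l p)"
        by (simp add: cost_tensor_path[OF l p] ennreal_mult')
    qed
    also have "\<dots> = ennreal (\<Sum>p\<in>paths D l. inner_cost l p * M l p)"
      using term_nonneg l by (intro sum_ennreal) auto
    finally show ?thesis .
  qed
  then have "ot_objective D M = (\<Sum>l\<in>comms D. ennreal (\<Sum>p\<in>paths D l. inner_cost l p * M l p))"
    by (simp add: ot_objective_def)
  also have "\<dots> = ennreal (\<Sum>l\<in>comms D. \<Sum>p\<in>paths D l. inner_cost l p * M l p)"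
    using term_nonneg by (intro sum_ennreal sum_nonneg) auto
  finally show ?thesis
    by (simp add: flow_objective_eq[OF feas])
qed

section \<open>Transfer of feasible and optimal solutions\<close>

lemma supported_extend_by_zero: "supported (extend_by_zero x)"
  by (simp add: supported_def extend_by_zero_def)

lemma flow_objective_cong:
  assumes "\<And>l p. l \<in> comms D \<Longrightarrow> p \<in> paths D l \<Longrightarrow> x l p = y l p"
  shows "flow_objective D x = flow_objective D y"
  unfolding flow_objective_def using assms by (intro sum.cong) auto

lemma flow_feasible_cong:
  assumes "\<And>l p. l \<in> comms D \<Longrightarrow> p \<in> paths D l \<Longrightarrow> x l p = y l p"
  shows "flow_feasible D x \<longleftrightarrow> flow_feasible D y"
proof -
  have "(\<Sum>p\<in>paths D l. of_bool (e = p t) * x l p) = (\<Sum>p\<in>paths D l. of_bool (e = p t) * y l p)"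
    if "l \<in> comms D" for l e t
    using assms that by (intro sum.cong) auto
  then show ?thesis
    unfolding flow_feasible_def using assms by (simp cong: sum.cong)
qed

lemma flow_feasible_extend_by_zero: "flow_feasible D (extend_by_zero x) \<longleftrightarrow> flow_feasible D x"
  by (rule flow_feasible_cong) (simp add: extend_by_zero_def)

lemma flow_objective_extend_by_zero: "flow_objective D (extend_by_zero x) = flow_objective D x"
  by (rule flow_objective_cong) (simp add: extend_by_zero_def)

lemma ot_of_flow:
  assumes "flow_feasible D x"
  shows "ot_feasible D (extend_by_zero x)"
    and "ot_objective D (extend_by_zero x) = ennreal (flow_objective D x - terminal_cost D)"
  using assms feasible_iff_if_supported[OF supported_extend_by_zero]
    ot_objective_supported[OF supported_extend_by_zero]
  by (simp_all add: flow_feasible_extend_by_zero flow_objective_extend_by_zero)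

text \<open>The tensor itself serves as the flow, since finite cost makes it supported.\<close>

lemma flow_of_ot:
  assumes "ot_feasible D M" "ot_objective D M < \<infinity>"
  shows "flow_feasible D M"
    and "ot_objective D M = ennreal (flow_objective D M - terminal_cost D)"
    and "corresponds D M M"
proof -
  have sup: "supported M"
    using assms by (rule supported_if_finite_objective)
  show feas: "flow_feasible D M"
    using assms(1) feasible_iff_if_supported[OF sup] by simp
  show "ot_objective D M = ennreal (flow_objective D M - terminal_cost D)"
    using sup feas by (rule ot_objective_supported)
  show "corresponds D M M"
    using sup by (auto simp: corresponds_def supported_def)
qed

lemma corresponds_extend_by_zero: "corresponds D (extend_by_zero x) x"
  by (simp add: corresponds_def extend_by_zero_def)

text \<open>Competitors of infinite cost are beaten trivially; the others are feasible flows
  themselves, so the optimality of \<open>x\<close> applies to them.\<close>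

lemma ot_optimal_if_flow_optimal:
  assumes opt: "flow_optimal D x"
  shows "ot_optimal D (extend_by_zero x)"
  unfolding is_arg_min_linorder
proof (intro conjI allI impI)
  have x: "flow_feasible D x" and le: "\<And>y. flow_feasible D y \<Longrightarrow> flow_objective D x \<le> flow_objective D y"
    using opt by (auto simp: is_arg_min_linorder)
  show "ot_feasible D (extend_by_zero x)"
    using x by (rule ot_of_flow)
  show "ot_objective D (extend_by_zero x) \<le> ot_objective D M" if M: "ot_feasible D M" for M
  proof (cases "ot_objective D M < \<infinity>")
    case True
    show ?thesis
      using flow_of_ot[OF M True] ot_of_flow[OF x] le[of M] by (simp add: ennreal_leI)
  next
    case False
    then have "ot_objective D M = \<infinity>" by (simp add: less_top[symmetric])
    then show ?thesis by simp
  qed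
qed

lemma flow_optimal_if_ot_optimal:
  assumes opt: "ot_optimal D M" and fin: "ot_objective D M < \<infinity>"
  shows "flow_optimal D M"
  unfolding is_arg_min_linorder
proof (intro conjI allI impI)
  have feas: "ot_feasible D M" and le: "\<And>N. ot_feasible D N \<Longrightarrow> ot_objective D M \<le> ot_objective D N"
    using opt by (auto simp: is_arg_min_linorder)
  show "flow_feasible D M"
    using feas fin by (rule flow_of_ot)
  show "flow_objective D M \<le> flow_objective D y" if y: "flow_feasible D y" for y
    \<comment> \<open>The bound on \<open>y\<close> makes the right-hand difference nonnegative, so
      that \<le> under \<open>ennreal\<close> gives \<le> of the reals.\<close>
    using le[OF ot_of_flow(1)[OF y]] flow_objective_ge_terminal_cost[OF y]
    by (simp add: flow_of_ot(2)[OF feas fin] ot_of_flow(2)[OF y])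
qed

section \<open>Existence of an optimal flow\<close>

lemma flow_bounded_by_supply:
  assumes feas: "flow_feasible D x" and l: "l \<in> comms D" and p: "p \<in> paths D l"
  shows "x l p \<le> supply_at D l (p 1)"
proof -
  have "of_bool (p 1 = p 1) * x l p \<le> (\<Sum>q\<in>paths D l. of_bool (p 1 = q 1) * x l q)"
    using feas l p by (intro member_le_sum) (auto simp: flow_feasible_def finite_paths)
  also have "\<dots> = supply_at D l (p 1)"
    using feas l p by (auto simp: flow_feasible_def paths_def)
  finally show ?thesis by simp
qed

text \<open>A continuous function attains its minimum on a non-empty compact set. Flows are
  uncurried so as to be points of a single product space.\<close>

lemma flow_optimal_exists:
  assumes "flow_feasible D x\<^sub>0"
  shows "\<exists>x. flow_optimal D x"
proof -
  define K where "K = Sigma (comms D) (paths D)"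
  \<comment> \<open>Pinning the coordinates outside \<open>K\<close> to zero makes \<open>B\<close>
    a product of compact sets over the whole index type, compact by Tychonoff's theorem.\<close>
  define B where "B = (\<Pi>\<^sub>E k\<in>UNIV. if k \<in> K then {0..supply_at D (fst k) (snd k 1)} else {0::real})"
  define F where "F = {y. flow_feasible D (curry y)}"
  have "compact B"
    unfolding B_def
    by (subst compactin_euclidean_iff[symmetric], subst euclidean_product_topology[symmetric])
      (simp add: compactin_PiE)
  moreover have "closed F"
    unfolding F_def flow_feasible_def curry_def
    by (intro closed_Collect_conj closed_Collect_ball closed_Collect_le closed_Collect_eq
        continuous_intros continuous_on_product_coordinates)
  ultimately have "compact (B \<inter> F)"
    by (rule compact_Int_closed)
  \<comment> \<open>Every feasible flow has a representative in \<open>B \<inter> F\<close> with the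
    same objective. This shows that the set is non-empty and later extends the minimality of
    \<open>y\<close> to all feasible flows.\<close>
  moreover have in_BF: "(\<lambda>(l, p). extend_by_zero x l p) \<in> B \<inter> F" if "flow_feasible D x" for x
    using that flow_bounded_by_supply[OF that]
    by (auto simp: B_def F_def K_def curry_def flow_feasible_extend_by_zero)
      (auto simp: extend_by_zero_def flow_feasible_def)
  moreover have "continuous_on (B \<inter> F) (\<lambda>y. flow_objective D (curry y))"
    unfolding flow_objective_def curry_def
    by (intro continuous_intros
        continuous_on_subset[OF continuous_on_product_coordinates subset_UNIV])
  ultimately obtain y where y: "y \<in> B \<inter> F"
    and min: "\<And>z. z \<in> B \<inter> F \<Longrightarrow> flow_objective D (curry y) \<le> flow_objective D (curry z)"
    using continuous_attains_inf[of "B \<inter> F" "\<lambda>y. flow_objective D (curry y)"] assms by blast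
  have "flow_objective D (curry y) \<le> flow_objective D x" if "flow_feasible D x" for x
    using min[OF in_BF[OF that]] by (simp add: curry_def flow_objective_extend_by_zero)
  then have "flow_optimal D (curry y)"
    using y by (simp add: is_arg_min_linorder F_def)
  then show ?thesis by blast
qed

section \<open>Optimal values and the correspondence\<close>

lemma terminal_cost_zero: "zero_terminal_edge_costs D \<Longrightarrow> terminal_cost D = 0"
  by (simp add: terminal_cost_def zero_terminal_edge_costs_def)

text \<open>Both values come from one optimal flow, with \<open>v\<close> its objective minus
  \<open>terminal_cost D\<close>; its extension by zero attains the tensor optimum.\<close>

lemma optimal_values:
  assumes "flow_feasible D x\<^sub>0"
  obtains v where "v \<ge> 0"
    and "has_optimal_value (ot_objective D) (ot_feasible D) (ennreal v)"
    and "has_optimal_value (flow_objective D) (flow_feasible D) (v + terminal_cost D)"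
proof -
  obtain x where opt: "flow_optimal D x"
    using flow_optimal_exists[OF assms] by blast
  then have feas: "flow_feasible D x"
    by (simp add: is_arg_min_def)
  show thesis
  proof
    show "flow_objective D x - terminal_cost D \<ge> 0"
      using flow_objective_ge_terminal_cost[OF feas] by simp
    show "has_optimal_value (ot_objective D) (ot_feasible D)
        (ennreal (flow_objective D x - terminal_cost D))"
      unfolding has_optimal_value_def
      using ot_optimal_if_flow_optimal[OF opt] ot_of_flow(2)[OF feas] by blast
    show "has_optimal_value (flow_objective D) (flow_feasible D)
        (flow_objective D x - terminal_cost D + terminal_cost D)"
      unfolding has_optimal_value_def using opt by auto
  qed
qed

end

theorem theorem2:
  fixes D :: "'v flow_data"
  assumes "valid_flow_data D"
  shows
    "((\<exists>M. ot_feasible D M \<and> ot_objective D M < \<infinity>) \<longrightarrow>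
        (\<exists>v::real. v \<ge> 0 \<and>
           has_optimal_value (ot_objective D) (ot_feasible D) (ennreal v) \<and>
           has_optimal_value (flow_objective D) (flow_feasible D) (v + terminal_cost D) \<and>
           (zero_terminal_edge_costs D \<longrightarrow>
              has_optimal_value (flow_objective D) (flow_feasible D) v)) \<and>
        (\<forall>M. ot_optimal D M \<longrightarrow> (\<exists>x. flow_optimal D x \<and> corresponds D M x))) \<and>
     ((\<exists>x. flow_feasible D x) \<longrightarrow>
        (\<exists>v::real. v \<ge> 0 \<and>
           has_optimal_value (flow_objective D) (flow_feasible D) (v + terminal_cost D) \<and>
           has_optimal_value (ot_objective D) (ot_feasible D) (ennreal v) \<and>
           (zero_terminal_edge_costs D \<longrightarrow>
              has_optimal_value (flow_objective D) (flow_feasible D) v)) \<and>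
        (\<forall>x. flow_optimal D x \<longrightarrow> (\<exists>M. ot_optimal D M \<and> corresponds D M x)))"
proof (intro conjI impI allI)
  assume "\<exists>M. ot_feasible D M \<and> ot_objective D M < \<infinity>"
  then obtain M\<^sub>0 where M\<^sub>0: "ot_feasible D M\<^sub>0" "ot_objective D M\<^sub>0 < \<infinity>"
    by blast
  show "\<exists>v::real. v \<ge> 0 \<and>
      has_optimal_value (ot_objective D) (ot_feasible D) (ennreal v) \<and>
      has_optimal_value (flow_objective D) (flow_feasible D) (v + terminal_cost D) \<and>
      (zero_terminal_edge_costs D \<longrightarrow> has_optimal_value (flow_objective D) (flow_feasible D) v)"
    using optimal_values[OF assms flow_of_ot(1)[OF assms M\<^sub>0]] terminal_cost_zero[OF assms]
    by (metis add.right_neutral)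
  show "\<exists>x. flow_optimal D x \<and> corresponds D M x" if opt: "ot_optimal D M" for M
  proof -
    \<comment> \<open>Comparison with \<open>M\<^sub>0\<close> gives the optimal tensor finite cost,
      so it can be taken as the flow \<open>x\<close> itself.\<close>
    have feas: "ot_feasible D M" and "ot_objective D M \<le> ot_objective D M\<^sub>0"
      using opt M\<^sub>0(1) by (auto simp: is_arg_min_linorder)
    then have "ot_objective D M < \<infinity>"
      using M\<^sub>0(2) by (simp add: order.strict_trans1)
    then show ?thesis
      using flow_optimal_if_ot_optimal[OF assms opt] flow_of_ot(3)[OF assms feas] by blast
  qed
next
  assume "\<exists>x. flow_feasible D x"
  then obtain x\<^sub>0 where "flow_feasible D x\<^sub>0"
    by blast
  then show "\<exists>v::real. v \<ge> 0 \<and>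
      has_optimal_value (flow_objective D) (flow_feasible D) (v + terminal_cost D) \<and>
      has_optimal_value (ot_objective D) (ot_feasible D) (ennreal v) \<and>
      (zero_terminal_edge_costs D \<longrightarrow> has_optimal_value (flow_objective D) (flow_feasible D) v)"
    using optimal_values[OF assms] terminal_cost_zero[OF assms] by (metis add.right_neutral)
  show "\<exists>M. ot_optimal D M \<and> corresponds D M x" if "flow_optimal D x" for x
    \<comment> \<open>As \<open>x\<close> may be non-zero off the paths, the witness is its
      extension by zero.\<close>
    using ot_optimal_if_flow_optimal[OF assms that] corresponds_extend_by_zero[OF assms] by blast
qed

end
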